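(* Let $H=D+VV^\top$ with symmetric positive definite $D\in\mathbb{R}^{m\times m}$ and arbitrary $V\in\mathbb{R}^{m\times n}$. Let $P=[\bar P,\underline{P}]\in\mathbb{R}^{n\times n}$ (a partition of the columns of $P$ into two blocks $\bar P$ and $\underline P$) satisfy $PP^\top=I_n$. Then the preconditioner $\hat H(\bar P)=D+V\bar P\bar P^\top V^\top$ has condition number $$\kappa_{\bar P}\le 1+\lambda_{\max}\big(\hat H(\bar P)^{-\frac12}V\underline{P}\,\underline{P}^\top V^\top\hat H(\bar P)^{-\frac12}\big).$$ Equality holds if and only if $\mathrm{rank}(V\underline{P})<m$.
   Context: $\lambda_{\max}$ and $\lambda_{\min}$ denote the largest and smallest eigenvalue of a symmetric matrix. The condition number belonging to the preconditioner $\hat H(\bar P)$ is $$\kappa_{\bar P}:=\frac{\lambda_{\max}(\hat H(\bar P)^{-1/2}H\hat H(\bar P)^{-1/2})}{\lambda_{\min}(\hat H(\bar P)^{-1/2}H\hat H(\bar P)^{-1/2})}.$$ *)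

theory Defs
  imports
    "Jordan_Normal_Form.Spectral_Radius"
    "Jordan_Normal_Form.DL_Rank"
begin

definition append_cols :: "'a mat \<Rightarrow> 'a mat \<Rightarrow> 'a mat" where
  "append_cols A B = mat_of_cols (dim_row A) (cols A @ cols B)"

definition sym_pos_def :: "nat \<Rightarrow> real mat \<Rightarrow> bool" where
  "sym_pos_def m A \<longleftrightarrow>
     A \<in> carrier_mat m m \<and> A\<^sup>T = A \<and>
     (\<forall>v \<in> carrier_vec m. v \<noteq> 0\<^sub>v m \<longrightarrow> v \<bullet> (A *\<^sub>v v) > 0)"

text \<open>The principal square root. It is only meaningful for a symmetric positive definite
  argument, which has exactly one symmetric positive definite square root.\<close>

definition mat_sqrt :: "real mat \<Rightarrow> real mat" where
  "mat_sqrt A = (THE R. sym_pos_def (dim_row A) R \<and> R * R = A)"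

definition mat_inv_sqrt :: "real mat \<Rightarrow> real mat" where
  "mat_inv_sqrt A = the (mat_inverse (mat_sqrt A))"

text \<open>The largest and smallest eigenvalue are used only for real symmetric matrices of positive
  dimension, whose real spectrum is finite and nonempty.\<close>

definition lambda_max :: "real mat \<Rightarrow> real" where
  "lambda_max A = Max (spectrum A)"

definition lambda_min :: "real mat \<Rightarrow> real" where
  "lambda_min A = Min (spectrum A)"

text \<open>The condition number of \<open>H\<close> under the split preconditioner \<open>K\<close>, that is, of
  \<open>K\<^sup>-\<^sup>1\<^sup>/\<^sup>2 H K\<^sup>-\<^sup>1\<^sup>/\<^sup>2\<close>.\<close>

definition precond_cond_number :: "real mat \<Rightarrow> real mat \<Rightarrow> real" where
  "precond_cond_number K H =
     lambda_max (mat_inv_sqrt K * H * mat_inv_sqrt K) /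
     lambda_min (mat_inv_sqrt K * H * mat_inv_sqrt K)"

definition preconditioner :: "real mat \<Rightarrow> real mat \<Rightarrow> real mat \<Rightarrow> real mat" where
  "preconditioner D V Q = D + V * Q * Q\<^sup>T * V\<^sup>T"

end

theory Submission
  imports Defs
begin

text \<open>Write \<open>K\<close> for the preconditioner, \<open>S = K\<^sup>-\<^sup>1\<^sup>/\<^sup>2\<close>, \<open>Y = V P2\<close> and \<open>G = (S Y) (S Y)\<^sup>T\<close>. Since
\<open>P1 P1\<^sup>T + P2 P2\<^sup>T = P P\<^sup>T = 1\<close>, the matrix \<open>H\<close> is \<open>K + Y Y\<^sup>T\<close>, so that \<open>S H S = 1 + G\<close>. The eigenvalues of
\<open>S H S\<close> are those of \<open>G\<close> shifted by one, so the condition number is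
\<open>(1 + \<lambda>\<^sub>m\<^sub>a\<^sub>x(G)) / (1 + \<lambda>\<^sub>m\<^sub>i\<^sub>n(G))\<close>. As a Gram matrix, \<open>G\<close> has nonnegative eigenvalues.
The quotient is therefore at most
\<open>1 + \<lambda>\<^sub>m\<^sub>a\<^sub>x(G)\<close>, with equality exactly if \<open>\<lambda>\<^sub>m\<^sub>i\<^sub>n(G) = 0\<close>, that is, if \<open>G = S (Y Y\<^sup>T) S\<close> is singular.
Because \<open>S\<close> is invertible this means that \<open>Y Y\<^sup>T\<close> is singular, which is equivalent to
\<open>rank Y < m\<close> (\<open>rank_less_iff_gram_singular\<close>).

The argument presupposes that the objects in the statement are what their names say. The square root of \<open>K\<close>
is a definite description, so it requires existence and uniqueness of a positive definite root. Both follow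
from the spectral theorem \<open>real_symmetric_diagonalization\<close>, proved by deflation with Householder reflections.
The extreme eigenvalues are a maximum and a minimum over the real spectrum, which is nonempty because
a real symmetric matrix has a real eigenvalue (\<open>real_symmetric_eigenvalue_exists\<close>).\<close>

section \<open>The spectral theorem for real symmetric matrices\<close>

text \<open>Over \<open>\<complex>\<close> there is an eigenpair \<open>(c, v)\<close>. Moving a real symmetric matrix across the
Hermitian form \<open>conjugate v \<bullet> v\<close> shows that \<open>c\<close> equals its own conjugate, so \<open>c\<close> is a real
root of the characteristic polynomial.\<close>

lemma real_symmetric_eigenvalue_exists:
  fixes A :: "real mat"
  assumes A: "A \<in> carrier_mat n n" and sym: "A\<^sup>T = A" and n: "n \<noteq> 0"
  shows "\<exists>e. eigenvalue A e"
proof -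
  let ?C = "map_mat complex_of_real A"
  have C: "?C \<in> carrier_mat n n" using A by auto
  obtain c where "eigenvalue ?C c"
    using spectrum_non_empty[OF C] n by (auto simp: spectrum_def)
  then obtain v where v: "v \<in> carrier_vec n" "v \<noteq> 0\<^sub>v n" "?C *\<^sub>v v = c \<cdot>\<^sub>v v"
    using A by (auto simp: eigenvalue_def eigenvector_def)
  have cv: "conjugate v \<in> carrier_vec n" using v by simp
  have Ct: "?C\<^sup>T = ?C" using sym by (simp add: map_mat_transpose)
  have conjC: "conjugate (?C *\<^sub>v v) = ?C *\<^sub>v conjugate v"
    using A v(1) by (intro eq_vecI) (auto simp: scalar_prod_def sum_conjugate conjugate_dist_mul)
  have "c * (conjugate v \<bullet> v) = conjugate v \<bullet> (?C *\<^sub>v v)"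
    using v cv by simp
  also have "\<dots> = (?C *\<^sub>v conjugate v) \<bullet> v"
    using transpose_vec_mult_scalar[OF C v(1) cv] Ct by simp
  also have "\<dots> = (conjugate c \<cdot>\<^sub>v conjugate v) \<bullet> v"
    using v by (simp flip: conjC add: conjugate_smult_vec)
  also have "\<dots> = conjugate c * (conjugate v \<bullet> v)"
    using v cv by simp
  finally have "c * (conjugate v \<bullet> v) = conjugate c * (conjugate v \<bullet> v)" .
  moreover have "conjugate v \<bullet> v \<noteq> 0"
    using v conjugate_square_eq_0_vec[OF v(1)] comm_scalar_prod[OF v(1) cv] by simp
  ultimately have "c = cnj c" by simp
  then have "c \<in> \<real>" by (simp add: Reals_cnj_iff)
  then obtain r where r: "c = complex_of_real r" by (auto elim: Reals_cases)
  have "poly (char_poly ?C) c = 0"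
    using \<open>eigenvalue ?C c\<close> eigenvalue_root_char_poly[OF C] by simp
  then have "poly (char_poly A) r = 0"
    by (simp add: r of_real_hom.char_poly_hom[OF A])
  then show ?thesis using eigenvalue_root_char_poly[OF A] by blast
qed

lemma mult_mat_unit_vec:
  assumes "A \<in> carrier_mat nr n" and "i < n"
  shows "A *\<^sub>v unit_vec n i = col (A :: 'a :: semiring_1 mat) i"
  using assms by (intro eq_vecI) (auto simp: row_def)

lemma mult_mat_zero_vec:
  assumes "A \<in> carrier_mat nr n"
  shows "A *\<^sub>v 0\<^sub>v n = 0\<^sub>v nr"
  using assms by (intro eq_vecI) auto

text \<open>The Householder reflection in the hyperplane orthogonal to \<open>w = v - e\<close>, where \<open>e\<close> is the first
unit vector, is \<open>1 - (2 / (w \<bullet> w)) w w\<^sup>T\<close>. It swaps the two unit vectors \<open>e\<close> and \<open>v\<close>. It serves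
to extend \<open>v\<close> to an orthonormal basis.\<close>

lemma householder_reflection:
  fixes v :: "real vec"
  assumes v: "v \<in> carrier_vec n" and unit: "v \<bullet> v = 1" and n: "0 < n"
  shows "\<exists>Q \<in> carrier_mat n n. Q\<^sup>T = Q \<and> Q * Q = 1\<^sub>m n \<and> Q *\<^sub>v unit_vec n 0 = v"
proof -
  define e where "e = (unit_vec n 0 :: real vec)"
  define w where "w = v - e"
  define c where "c = 2 / (w \<bullet> w)"
  define Q where "Q = mat n n (\<lambda>(i, j). (if i = j then 1 else 0) - c * w $ i * w $ j)"
  have e: "e \<in> carrier_vec n" and w: "w \<in> carrier_vec n"
    using v by (auto simp: e_def w_def)
  have Q: "Q \<in> carrier_mat n n" by (simp add: Q_def)
  have Qt: "Q\<^sup>T = Q" by (intro eq_matI) (auto simp: Q_def)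
  have reflect: "Q *\<^sub>v x = x - (c * (w \<bullet> x)) \<cdot>\<^sub>v w" if x: "x \<in> carrier_vec n" for x
  proof (intro eq_vecI)
    fix i assume "i < dim_vec (x - (c * (w \<bullet> x)) \<cdot>\<^sub>v w)"
    then have i: "i < n" using w by simp
    have "(Q *\<^sub>v x) $ i = (\<Sum>j<n. ((if i = j then 1 else 0) - c * w $ i * w $ j) * x $ j)"
      using i x by (simp add: Q_def scalar_prod_def atLeast0LessThan)
    also have "\<dots> = (\<Sum>j<n. (if i = j then x $ j else 0) - c * w $ i * (w $ j * x $ j))"
      by (intro sum.cong) (auto simp: algebra_simps)
    also have "\<dots> = x $ i - c * w $ i * (\<Sum>j<n. w $ j * x $ j)"
      using i by (simp add: sum_subtractf sum_distrib_left)
    also have "\<dots> = (x - (c * (w \<bullet> x)) \<cdot>\<^sub>v w) $ i"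
      using i x w by (simp add: scalar_prod_def atLeast0LessThan)
    finally show "(Q *\<^sub>v x) $ i = (x - (c * (w \<bullet> x)) \<cdot>\<^sub>v w) $ i" .
  qed (use w Q in auto)
  \<comment> \<open>also true when \<open>w \<bullet> w = 0\<close>, as then \<open>c = 0\<close>\<close>
  have cw: "c * (c * (w \<bullet> w)) = 2 * c" by (simp add: c_def)
  have invol: "Q *\<^sub>v (Q *\<^sub>v x) = x" if x: "x \<in> carrier_vec n" for x
  proof -
    define t where "t = c * (w \<bullet> x)"
    have y: "Q *\<^sub>v x = x - t \<cdot>\<^sub>v w" and yc: "x - t \<cdot>\<^sub>v w \<in> carrier_vec n"
      using reflect x w by (auto simp: t_def)
    have "c * (w \<bullet> (x - t \<cdot>\<^sub>v w)) = t - c * (w \<bullet> x) * (c * (w \<bullet> w))"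
      using x w by (simp add: scalar_prod_minus_distrib[of _ n] t_def algebra_simps)
    also have "\<dots> = t - (c * (c * (w \<bullet> w))) * (w \<bullet> x)" by (simp add: algebra_simps)
    also have "\<dots> = - t" by (simp add: cw t_def)
    finally have "Q *\<^sub>v (Q *\<^sub>v x) = (x - t \<cdot>\<^sub>v w) - (- t) \<cdot>\<^sub>v w"
      using reflect[OF yc] y by simp
    also have "\<dots> = x" using x w by (intro eq_vecI) auto
    finally show ?thesis .
  qed
  have "Q * Q = 1\<^sub>m n"
  proof (rule mat_col_eqI)
    fix i assume "i < dim_col (1\<^sub>m n :: real mat)"
    then have i: "i < n" by simp
    have "col (Q * Q) i = Q *\<^sub>v (Q *\<^sub>v unit_vec n i)"
      by (simp only: col_mult2[OF Q Q i] mult_mat_unit_vec[OF Q i])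
    then show "col (Q * Q) i = col (1\<^sub>m n) i" using invol[of "unit_vec n i"] i by simp
  qed (use Q in auto)
  moreover have "Q *\<^sub>v e = v"
  proof -
    have ee: "e \<bullet> e = 1" using n by (simp add: e_def)
    have ww: "w \<bullet> w = 2 - 2 * (v \<bullet> e)" and we: "w \<bullet> e = v \<bullet> e - 1"
      using v e unit ee comm_scalar_prod[OF v e]
      by (simp_all add: w_def minus_scalar_prod_distrib[of _ n] scalar_prod_minus_distrib[of _ n])
    show ?thesis
    proof (cases "w \<bullet> w = 0")
      case True
      \<comment> \<open>the reflection is then the identity, as division by zero makes the factor vanish\<close>
      then have "w = 0\<^sub>v n" using conjugate_square_eq_0_vec[OF w] by simp
      then have "v $ i = e $ i" if "i < n" for i
        using that v e by (auto simp: w_def dest: arg_cong[of _ _ "\<lambda>u. u $ i"])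
      then have "v = e" using v e by (intro eq_vecI) auto
      then show ?thesis using reflect[OF e] True e w by (intro eq_vecI) (auto simp: c_def)
    next
      case False
      then have "c * (w \<bullet> e) = - 1" by (simp add: c_def ww we field_simps)
      then have "Q *\<^sub>v e = e - (- 1) \<cdot>\<^sub>v w" using reflect[OF e] by simp
      also have "\<dots> = v" using v e by (intro eq_vecI) (auto simp: w_def)
      finally show ?thesis .
    qed
  qed
  ultimately show ?thesis using Q Qt by (auto simp: e_def)
qed

text \<open>Deflation: conjugating with a reflection that takes the first unit vector to a unit eigenvector \<open>v\<close>
makes the first column a multiple of the first unit vector, and by symmetry the first row as well.
The remaining block is symmetric and one dimension smaller.\<close>

lemma real_symmetric_diagonalization:
  fixes A :: "real mat"
  assumes "A \<in> carrier_mat n n" and "A\<^sup>T = A"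
  shows "\<exists>U d. U \<in> carrier_mat n n \<and> U\<^sup>T * U = 1\<^sub>m n \<and> U * U\<^sup>T = 1\<^sub>m n \<and>
               A = U * mat_diag n d * U\<^sup>T"
  using assms
proof (induction n arbitrary: A)
  case 0
  then show ?case by (intro exI[of _ "1\<^sub>m 0"] exI[of _ "\<lambda>_. 0"]) (auto simp: mat_diag_def)
next
  case (Suc k)
  let ?n = "Suc k"
  have A: "A \<in> carrier_mat ?n ?n" and At: "A\<^sup>T = A" using Suc.prems by auto
  obtain e where "eigenvalue A e" using real_symmetric_eigenvalue_exists[OF A At] by auto
  then obtain w where w: "w \<in> carrier_vec ?n" "w \<noteq> 0\<^sub>v ?n" "A *\<^sub>v w = e \<cdot>\<^sub>v w"
    using A by (auto simp: eigenvalue_def eigenvector_def)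
  define v where "v = (1 / sqrt (w \<bullet> w)) \<cdot>\<^sub>v w"
  have "w \<bullet> w > 0" using w conjugate_square_greater_0_vec[OF w(1)] by simp
  then have unit: "v \<bullet> v = 1" and v: "v \<in> carrier_vec ?n"
    using w(1) by (auto simp: v_def field_simps)
  have Av: "A *\<^sub>v v = e \<cdot>\<^sub>v v"
    using A w by (simp add: v_def mult_mat_vec smult_smult_assoc mult.commute)
  obtain Q where Q: "Q \<in> carrier_mat ?n ?n" and Qt: "Q\<^sup>T = Q" and QQ: "Q * Q = 1\<^sub>m ?n"
    and Qe: "Q *\<^sub>v unit_vec ?n 0 = v"
    using householder_reflection[OF v unit] by auto
  have QQx: "Q * (Q * X) = X" if "X \<in> carrier_mat ?n ?n" for X
    using assoc_mult_mat[OF Q Q that] QQ that by simp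
  define B where "B = Q * (A * Q)"
  have B: "B \<in> carrier_mat ?n ?n" using A Q by (simp add: B_def)
  have Bt: "B\<^sup>T = B"
    unfolding B_def using A Q by (simp add: transpose_mult[of _ ?n ?n _ ?n] Qt At)
  have "Q *\<^sub>v v = unit_vec ?n 0"
    using Qe QQ assoc_mult_mat_vec[OF Q Q unit_vec_carrier[of ?n 0]] by simp
  then have "B *\<^sub>v unit_vec ?n 0 = e \<cdot>\<^sub>v unit_vec ?n 0"
    using A Q v Qe Av by (simp add: B_def assoc_mult_mat_vec[of _ ?n ?n _ ?n] mult_mat_vec[of _ ?n ?n])
  then have "col B 0 = e \<cdot>\<^sub>v unit_vec ?n 0" using B by (simp add: mult_mat_unit_vec[of _ ?n ?n])
  then have B0: "B $$ (i, 0) = (if i = 0 then e else 0)" if "i < ?n" for i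
    using that B by (auto simp: unit_vec_def dest!: arg_cong[of _ _ "\<lambda>u. u $ i"])
  have B0': "B $$ (0, j) = (if j = 0 then e else 0)" if "j < ?n" for j
    using that B B0[OF that] arg_cong[OF Bt, of "\<lambda>M. M $$ (0, j)"] by auto
  define C where "C = mat k k (\<lambda>(i, j). B $$ (Suc i, Suc j))"
  have C: "C \<in> carrier_mat k k" by (simp add: C_def)
  have "C\<^sup>T = C"
  proof (rule eq_matI)
    fix i j assume "i < dim_row C" "j < dim_col C"
    then show "C\<^sup>T $$ (i, j) = C $$ (i, j)"
      using B arg_cong[OF Bt, of "\<lambda>M. M $$ (Suc i, Suc j)"] by (simp add: C_def)
  qed (use C in auto)
  then obtain W d where W: "W \<in> carrier_mat k k" "W\<^sup>T * W = 1\<^sub>m k" "W * W\<^sup>T = 1\<^sub>m k"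
    and CW: "C = W * mat_diag k d * W\<^sup>T" using Suc.IH[OF C] by blast
  \<comment> \<open>\<open>Q A Q\<close> is block diagonal with blocks \<open>E = (e)\<close> and \<open>C\<close>; \<open>U\<close> rotates the second block only\<close>
  define E where "E = (mat_diag 1 (\<lambda>_. e) :: real mat)"
  define U where "U = four_block_mat (1\<^sub>m 1) (0\<^sub>m 1 k) (0\<^sub>m k 1) W"
  define f where "f = (\<lambda>i. case i of 0 \<Rightarrow> e | Suc j \<Rightarrow> d j)"
  have U: "U \<in> carrier_mat ?n ?n" using W by (auto simp: U_def)
  have Ut: "U\<^sup>T = four_block_mat (1\<^sub>m 1) (0\<^sub>m 1 k) (0\<^sub>m k 1) W\<^sup>T"
    unfolding U_def using W by (subst transpose_four_block_mat[of _ 1 1 _ k _ k]) auto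
  have E: "E \<in> carrier_mat 1 1" by (simp add: E_def)
  have F: "mat_diag ?n f = four_block_mat E (0\<^sub>m 1 k) (0\<^sub>m k 1) (mat_diag k d)"
    by (intro eq_matI) (auto simp: mat_diag_def E_def f_def split: nat.split)
  have Beq: "B = four_block_mat E (0\<^sub>m 1 k) (0\<^sub>m k 1) C"
    using B B0 B0' by (intro eq_matI) (auto simp: E_def C_def mat_diag_def)
  have UtU: "U\<^sup>T * U = 1\<^sub>m ?n"
    unfolding Ut unfolding U_def using W
    by (subst mult_four_block_mat[of _ 1 1 _ k _ k _ _ 1 _ k]) auto
  have UUt: "U * U\<^sup>T = 1\<^sub>m ?n"
    using mat_mult_left_right_inverse[OF _ U UtU] U by simp
  have WD: "W * mat_diag k d \<in> carrier_mat k k"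
    using W(1) mat_diag_dim by (rule mult_carrier_mat)
  have "U * mat_diag ?n f * U\<^sup>T = B"
    unfolding Ut F Beq CW unfolding U_def
    using W E left_mult_zero_mat[OF mat_diag_dim[of k d], of 1]
      right_mult_zero_mat[OF WD, of 1] left_add_zero_mat[OF mult_carrier_mat[OF WD, of "W\<^sup>T" k]]
    by (subst mult_four_block_mat[of _ 1 1 _ k _ k _ _ 1 _ k], simp_all)
       (subst mult_four_block_mat[of _ 1 1 _ k _ k _ _ 1 _ k], simp_all)
  then have Bf: "B = U * (mat_diag ?n f * U\<^sup>T)"
    using U by (simp add: assoc_mult_mat[of _ ?n ?n _ ?n _ ?n])
  let ?V = "Q * U"
  have V: "?V \<in> carrier_mat ?n ?n" and Vt: "?V\<^sup>T = U\<^sup>T * Q"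
    using Q U by (simp_all add: transpose_mult[of _ ?n ?n _ ?n] Qt)
  have VtV: "?V\<^sup>T * ?V = 1\<^sub>m ?n"
    using Q U UtU by (simp add: Vt assoc_mult_mat[of _ ?n ?n _ ?n _ ?n] QQx)
  have VVt: "?V * ?V\<^sup>T = 1\<^sub>m ?n"
    using mat_mult_left_right_inverse[OF _ V VtV] V by simp
  have "?V * mat_diag ?n f * ?V\<^sup>T = Q * (B * Q)"
    using Q U mult_carrier_mat[OF mat_diag_dim[of ?n f], of "U\<^sup>T" ?n]
    by (simp add: Vt Bf assoc_mult_mat[of _ ?n ?n _ ?n _ ?n])
  also have "\<dots> = A"
    using Q A QQ by (simp add: B_def assoc_mult_mat[of _ ?n ?n _ ?n _ ?n] QQx)
  finally show ?case using V VtV VVt by metis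
qed

section \<open>Square roots of positive definite matrices\<close>

text \<open>In the coordinates \<open>u = U\<^sup>T *\<^sub>v v\<close> the quadratic form is \<open>\<Sum>i. d i * u\<^sub>i\<^sup>2\<close>.\<close>

lemma pos_def_diagonalized_iff:
  fixes U :: "real mat"
  assumes U: "U \<in> carrier_mat n n" and UtU: "U\<^sup>T * U = 1\<^sub>m n" and UUt: "U * U\<^sup>T = 1\<^sub>m n"
  shows "sym_pos_def n (U * mat_diag n d * U\<^sup>T) \<longleftrightarrow> (\<forall>i<n. d i > 0)"
proof -
  let ?A = "U * mat_diag n d * U\<^sup>T"
  have A: "?A \<in> carrier_mat n n" using U by (intro mult_carrier_mat[of _ n n]) auto
  have "(mat_diag n d)\<^sup>T = mat_diag n d" by (intro eq_matI) (auto simp: mat_diag_def)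
  then have At: "?A\<^sup>T = ?A"
    using U mat_diag_dim[of n d] mult_carrier_mat[OF mat_diag_dim[of n d], of "U\<^sup>T" n]
    by (simp add: transpose_mult[OF U] transpose_mult[OF mat_diag_dim] assoc_mult_mat[of _ n n _ n _ n])
  have form: "v \<bullet> (?A *\<^sub>v v) = (\<Sum>i<n. d i * ((U\<^sup>T *\<^sub>v v) $ i)\<^sup>2)" if v: "v \<in> carrier_vec n" for v
  proof -
    define u where "u = U\<^sup>T *\<^sub>v v"
    have u: "u \<in> carrier_vec n" using U v by (simp add: u_def)
    have Du: "mat_diag n d *\<^sub>v u = vec n (\<lambda>i. d i * u $ i)"
      using u by (intro eq_vecI)
        (auto simp: mat_diag_def scalar_prod_def atLeast0LessThan if_distrib[of "\<lambda>x. x * _"] cong: if_cong)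
    have "?A *\<^sub>v v = U *\<^sub>v (mat_diag n d *\<^sub>v u)"
      using U v by (simp add: u_def assoc_mult_mat_vec[of _ n n _ n])
    then have "v \<bullet> (?A *\<^sub>v v) = u \<bullet> (mat_diag n d *\<^sub>v u)"
      using transpose_vec_mult_scalar[OF U _ v, of "mat_diag n d *\<^sub>v u"] Du by (simp add: u_def)
    also have "\<dots> = (\<Sum>i<n. d i * (u $ i)\<^sup>2)"
      using u by (auto simp: Du scalar_prod_def atLeast0LessThan power2_eq_square intro!: sum.cong)
    finally show ?thesis by (simp add: u_def)
  qed
  show ?thesis
  proof
    assume pd: "sym_pos_def n ?A"
    show "\<forall>i<n. d i > 0"
    proof (intro allI impI)
      fix i assume i: "i < n"
      let ?e = "unit_vec n i :: real vec"
      define v where "v = U *\<^sub>v ?e"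
      have v: "v \<in> carrier_vec n" using U by (simp add: v_def)
      have Uv: "U\<^sup>T *\<^sub>v v = ?e"
        using U UtU assoc_mult_mat_vec[of "U\<^sup>T" n n U n ?e] by (simp add: v_def)
      have "v \<noteq> 0\<^sub>v n"
      proof
        assume "v = 0\<^sub>v n"
        then have "?e = 0\<^sub>v n" using Uv U mult_mat_zero_vec[of "U\<^sup>T" n n] by simp
        then show False using i by (auto dest: arg_cong[of _ _ "\<lambda>u. u $ i"])
      qed
      then have "v \<bullet> (?A *\<^sub>v v) > 0" using pd v by (auto simp: sym_pos_def_def)
      moreover have "v \<bullet> (?A *\<^sub>v v) = (\<Sum>j<n. if j = i then d j else 0)"
        unfolding form[OF v] Uv using i by (intro sum.cong) auto
      ultimately show "d i > 0" using i by simp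
    qed
  next
    assume d: "\<forall>i<n. d i > 0"
    show "sym_pos_def n ?A"
      unfolding sym_pos_def_def
    proof (intro conjI ballI impI A At)
      fix v :: "real vec" assume v: "v \<in> carrier_vec n" and v0: "v \<noteq> 0\<^sub>v n"
      have vU: "v = U *\<^sub>v (U\<^sup>T *\<^sub>v v)"
        using U UUt v assoc_mult_mat_vec[of U n n "U\<^sup>T" n v] by simp
      have "\<exists>i<n. (U\<^sup>T *\<^sub>v v) $ i \<noteq> 0"
      proof (rule ccontr)
        assume "\<not> ?thesis"
        then have "U\<^sup>T *\<^sub>v v = 0\<^sub>v n" using U by (intro eq_vecI) auto
        then show False using vU v0 mult_mat_zero_vec[OF U] by simp
      qed
      then obtain i where i: "i < n" "(U\<^sup>T *\<^sub>v v) $ i \<noteq> 0" by blast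
      have "0 < d i * ((U\<^sup>T *\<^sub>v v) $ i)\<^sup>2" using i d by simp
      also have "\<dots> \<le> (\<Sum>i<n. d i * ((U\<^sup>T *\<^sub>v v) $ i)\<^sup>2)"
        using i d by (intro member_le_sum) (auto simp: less_imp_le)
      finally show "0 < v \<bullet> (?A *\<^sub>v v)" using form[OF v] by simp
    qed
  qed
qed

lemma pos_def_square_root_exists:
  assumes "sym_pos_def n A"
  shows "\<exists>R. sym_pos_def n R \<and> R * R = A"
proof -
  obtain U d where U: "U \<in> carrier_mat n n" "U\<^sup>T * U = 1\<^sub>m n" "U * U\<^sup>T = 1\<^sub>m n"
    and A: "A = U * mat_diag n d * U\<^sup>T"
    using real_symmetric_diagonalization[of A n] assms by (auto simp: sym_pos_def_def)
  have d: "\<forall>i<n. d i > 0" using assms pos_def_diagonalized_iff[OF U] A by simp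
  define S where "S = mat_diag n (\<lambda>i. sqrt (d i))"
  have S: "S \<in> carrier_mat n n" by (simp add: S_def)
  have SS: "S * S = mat_diag n d"
    unfolding S_def mat_diag_diag using d by (auto simp: mat_diag_def intro!: eq_matI)
  have cancel: "U\<^sup>T * (U * X) = X" if "X \<in> carrier_mat n n" for X
    using assoc_mult_mat[of "U\<^sup>T" n n U n X n] U that by simp
  have "(U * S * U\<^sup>T) * (U * S * U\<^sup>T) = U * (S * S) * U\<^sup>T"
    using U(1) S by (simp add: assoc_mult_mat[of _ n n _ n _ n] cancel)
  moreover have "sym_pos_def n (U * S * U\<^sup>T)"
    unfolding S_def pos_def_diagonalized_iff[OF U] using d by simp
  ultimately show ?thesis using A SS by auto
qed

text \<open>Put \<open>X = R - T\<close>. From \<open>R R = T T\<close> follows \<open>X R + T X = 0\<close>. If \<open>u\<close> is an eigenvector of the symmetric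
matrix \<open>X\<close> with eigenvalue \<open>d\<close>, evaluating the form at \<open>u\<close> gives
\<open>d * (u \<bullet> R u + u \<bullet> T u) = 0\<close>, and the bracket is positive. So \<open>X\<close> has only the eigenvalue \<open>0\<close>, and
being diagonalizable it vanishes.\<close>

lemma pos_def_square_root_unique:
  assumes R: "sym_pos_def n R" and T: "sym_pos_def n T" and eq: "R * R = T * T"
  shows "R = T"
proof -
  have Rc: "R \<in> carrier_mat n n" "R\<^sup>T = R" and Tc: "T \<in> carrier_mat n n" "T\<^sup>T = T"
    using R T by (auto simp: sym_pos_def_def)
  define X where "X = R - T"
  have X: "X \<in> carrier_mat n n" "X\<^sup>T = X"
    using Rc Tc by (auto simp: X_def transpose_minus)
  have RT: "R = X + T" using Rc Tc by (auto simp: X_def)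
  obtain U d where U: "U \<in> carrier_mat n n" "U\<^sup>T * U = 1\<^sub>m n" "U * U\<^sup>T = 1\<^sub>m n"
    and XU: "X = U * mat_diag n d * U\<^sup>T"
    using real_symmetric_diagonalization[OF X] by blast
  have "d i = 0" if i: "i < n" for i
  proof -
    let ?e = "unit_vec n i :: real vec"
    define u where "u = U *\<^sub>v ?e"
    have u: "u \<in> carrier_vec n" using U by (simp add: u_def)
    have Utu: "U\<^sup>T *\<^sub>v u = ?e"
      using U assoc_mult_mat_vec[of "U\<^sup>T" n n U n ?e] by (simp add: u_def)
    have "u \<noteq> 0\<^sub>v n"
    proof
      assume "u = 0\<^sub>v n"
      then have "?e = 0\<^sub>v n" using Utu U mult_mat_zero_vec[of "U\<^sup>T" n n] by simp
      then show False using i by (auto dest: arg_cong[of _ _ "\<lambda>u. u $ i"])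
    qed
    then have pos: "u \<bullet> (R *\<^sub>v u) > 0" "u \<bullet> (T *\<^sub>v u) > 0"
      using R T u by (auto simp: sym_pos_def_def)
    have De: "mat_diag n d *\<^sub>v ?e = d i \<cdot>\<^sub>v ?e"
      using mult_mat_unit_vec[OF mat_diag_dim i, of d] i by (auto simp: mat_diag_def intro!: eq_vecI)
    have Xu: "X *\<^sub>v u = d i \<cdot>\<^sub>v u"
      using U u by (simp add: XU assoc_mult_mat_vec[of _ n n _ n] Utu De mult_mat_vec[of _ n n] u_def[symmetric])
    have Ru: "R *\<^sub>v u \<in> carrier_vec n" and Tu: "T *\<^sub>v u \<in> carrier_vec n"
      using Rc Tc u by auto
    have Rv: "R *\<^sub>v w = X *\<^sub>v w + T *\<^sub>v w" if "w \<in> carrier_vec n" for w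
      unfolding RT using that X Tc by (simp add: add_mult_distrib_mat_vec[of _ n n])
    have Xsym: "u \<bullet> (X *\<^sub>v w) = d i * (u \<bullet> w)" if "w \<in> carrier_vec n" for w
      using transpose_vec_mult_scalar[OF X(1) that u] X(2) Xu u that by simp
    have "R *\<^sub>v (R *\<^sub>v u) = T *\<^sub>v (T *\<^sub>v u)"
      using arg_cong[OF eq, of "\<lambda>M. M *\<^sub>v u"] Rc Tc u by (simp add: assoc_mult_mat_vec[of _ n n _ n])
    \<comment> \<open>the outer factor \<open>X\<close> is left alone: by symmetry it acts as \<open>d i\<close> on the left argument \<open>u\<close>\<close>
    moreover have "R *\<^sub>v (R *\<^sub>v u) = X *\<^sub>v (R *\<^sub>v u) + (d i \<cdot>\<^sub>v (T *\<^sub>v u) + T *\<^sub>v (T *\<^sub>v u))"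
      using Rv[OF Ru] Rv[OF u] Xu u Tu Tc X
      by (simp add: mult_add_distrib_mat_vec[of _ n n] mult_mat_vec[of _ n n])
    ultimately have "u \<bullet> (T *\<^sub>v (T *\<^sub>v u)) =
        u \<bullet> (X *\<^sub>v (R *\<^sub>v u) + (d i \<cdot>\<^sub>v (T *\<^sub>v u) + T *\<^sub>v (T *\<^sub>v u)))" by simp
    also have "\<dots> = d i * (u \<bullet> (R *\<^sub>v u)) + (d i * (u \<bullet> (T *\<^sub>v u)) + u \<bullet> (T *\<^sub>v (T *\<^sub>v u)))"
      using Ru Tu u Tc X by (simp add: scalar_prod_add_distrib[of _ n] Xsym)
    finally have "d i * (u \<bullet> (R *\<^sub>v u) + u \<bullet> (T *\<^sub>v u)) = 0" by (simp add: algebra_simps)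
    then show "d i = 0" using pos by simp
  qed
  then have "mat_diag n d = 0\<^sub>m n n" by (intro eq_matI) (auto simp: mat_diag_def)
  then have "X = 0\<^sub>m n n" using XU U by simp
  then show "R = T" using RT Tc by simp
qed

lemma pos_def_imp_det_nonzero:
  assumes "sym_pos_def n A"
  shows "det A \<noteq> 0"
proof
  assume "det A = 0"
  then obtain v where "v \<in> carrier_vec n" "v \<noteq> 0\<^sub>v n" "A *\<^sub>v v = 0\<^sub>v n"
    using assms det_0_iff_vec_prod_zero_field[of A n] by (auto simp: sym_pos_def_def)
  then show False using assms by (force simp: sym_pos_def_def)
qed

text \<open>All that is needed of \<open>K\<^sup>-\<^sup>1\<^sup>/\<^sup>2\<close>. Existence and uniqueness of the positive definite root make the
definite description in \<^const>\<open>mat_sqrt\<close> denote it, and its determinant being nonzero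
makes \<^const>\<open>mat_inverse\<close> return the inverse.\<close>

lemma mat_inv_sqrt_properties:
  assumes K: "sym_pos_def n K"
  shows "mat_inv_sqrt K \<in> carrier_mat n n" and "(mat_inv_sqrt K)\<^sup>T = mat_inv_sqrt K"
    and "det (mat_inv_sqrt K) \<noteq> 0" and "mat_inv_sqrt K * K * mat_inv_sqrt K = 1\<^sub>m n"
proof -
  define R where "R = mat_sqrt K"
  have dim: "dim_row K = n" using K by (auto simp: sym_pos_def_def)
  have "\<exists>!R. sym_pos_def n R \<and> R * R = K"
    using pos_def_square_root_exists[OF K] pos_def_square_root_unique by metis
  from theI'[OF this] have R: "sym_pos_def n R" and RR: "R * R = K"
    by (auto simp: R_def mat_sqrt_def dim)
  have Rc: "R \<in> carrier_mat n n" and Rt: "R\<^sup>T = R" using R by (auto simp: sym_pos_def_def)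
  obtain S where "mat_inverse R = Some S"
    using mat_inverse(1)[OF Rc, where b = "()"] det_non_zero_imp_unit[OF Rc pos_def_imp_det_nonzero[OF R], where b = "()"]
    by (cases "mat_inverse R") auto
  then have S: "S \<in> carrier_mat n n" and RS: "R * S = 1\<^sub>m n" and SR: "S * R = 1\<^sub>m n"
    and eq: "mat_inv_sqrt K = S"
    using mat_inverse(2)[OF Rc] by (auto simp: mat_inv_sqrt_def R_def)
  have "S\<^sup>T * R = 1\<^sub>m n"
    using arg_cong[OF RS, of transpose_mat] Rc S Rt by (simp add: transpose_mult[of _ n n])
  then have "S\<^sup>T = S\<^sup>T * (R * S)" using S RS by simp
  also have "\<dots> = S"
    using \<open>S\<^sup>T * R = 1\<^sub>m n\<close> S Rc assoc_mult_mat[of "S\<^sup>T" n n R n S n] by simp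
  finally have St: "S\<^sup>T = S" .
  have "det S * det R = 1" using det_mult[OF S Rc] SR by simp
  then have det: "det S \<noteq> 0" by auto
  have "S * K * S = (S * R) * (R * S)"
    using S Rc by (simp add: RR[symmetric] assoc_mult_mat[of _ n n _ n _ n])
  then have "S * K * S = 1\<^sub>m n" using RS SR by simp
  then show "mat_inv_sqrt K \<in> carrier_mat n n" "(mat_inv_sqrt K)\<^sup>T = mat_inv_sqrt K"
    "det (mat_inv_sqrt K) \<noteq> 0" "mat_inv_sqrt K * K * mat_inv_sqrt K = 1\<^sub>m n"
    using S St det eq by auto
qed

section \<open>Gram matrices\<close>

lemma gram_form_nonneg:
  fixes M :: "real mat"
  assumes M: "M \<in> carrier_mat m l" and v: "v \<in> carrier_vec m"
  shows "v \<bullet> (M * M\<^sup>T *\<^sub>v v) \<ge> 0"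
proof -
  have y: "M\<^sup>T *\<^sub>v v \<in> carrier_vec l" using M v by simp
  have "v \<bullet> (M * M\<^sup>T *\<^sub>v v) = (M\<^sup>T *\<^sub>v v) \<bullet> (M\<^sup>T *\<^sub>v v)"
    using transpose_vec_mult_scalar[OF M y v] M v by (simp add: assoc_mult_mat_vec[of _ m l _ m])
  then show ?thesis using conjugate_square_ge_0_vec[of "M\<^sup>T *\<^sub>v v"] by simp
qed

lemma gram_eigenvalue_nonneg:
  fixes M :: "real mat"
  assumes M: "M \<in> carrier_mat m l" and e: "eigenvalue (M * M\<^sup>T) e"
  shows "e \<ge> 0"
proof -
  obtain v where v: "v \<in> carrier_vec m" "v \<noteq> 0\<^sub>v m" "M * M\<^sup>T *\<^sub>v v = e \<cdot>\<^sub>v v"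
    using e M by (auto simp: eigenvalue_def eigenvector_def)
  then have "0 \<le> e * (v \<bullet> v)" using gram_form_nonneg[OF M v(1)] by simp
  moreover have "v \<bullet> v > 0" using v conjugate_square_greater_0_vec[OF v(1)] by simp
  ultimately show ?thesis by (simp add: zero_le_mult_iff)
qed

lemma congruence_gram:
  fixes V :: "'a :: comm_semiring_0 mat"
  assumes V: "V \<in> carrier_mat m n" and Q: "Q \<in> carrier_mat n k"
  shows "V * Q * Q\<^sup>T * V\<^sup>T = (V * Q) * (V * Q)\<^sup>T"
proof -
  have VQ: "V * Q \<in> carrier_mat m k" using V Q by simp
  show ?thesis
    unfolding transpose_mult[OF V Q] using V Q by (intro assoc_mult_mat[OF VQ]) auto
qed

text \<open>If \<open>M M\<^sup>T\<close> is invertible, every vector \<open>x\<close> equals \<open>M (M\<^sup>T (M M\<^sup>T)\<^sup>-\<^sup>1 x)\<close> and so lies in the column space,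
which therefore has dimension \<open>m\<close>. If \<open>M M\<^sup>T x = 0\<close> with \<open>x \<noteq> 0\<close>, then \<open>\<parallel>M\<^sup>T x\<parallel>\<^sup>2 = 0\<close>, so \<open>x\<close> is
orthogonal to the column space; a column space of full dimension would contain \<open>x\<close> itself.\<close>

lemma rank_less_iff_gram_singular:
  fixes M :: "real mat"
  assumes M: "M \<in> carrier_mat m l"
  shows "vec_space.rank m M < m \<longleftrightarrow> det (M * M\<^sup>T) = 0"
proof -
  interpret vec_space "TYPE(real)" m .
  have cols: "set (cols M) \<subseteq> carrier_vec m" using M cols_dim by blast
  have MM: "M * M\<^sup>T \<in> carrier_mat m m" using M by simp
  obtain S where S: "maximal S (\<lambda>T. T \<subseteq> set (cols M) \<and> lin_indpt T)"
    using maximal_exists_superset[of "set (cols M)" "\<lambda>T. T \<subseteq> set (cols M) \<and> lin_indpt T" "{}"]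
    by (auto simp: lin_dep_def)
  have rank: "rank M = card S" using rank_card_indpt[OF M S] .
  have Ssub: "S \<subseteq> set (cols M)" and Sli: "lin_indpt S" using S by (auto simp: maximal_def)
  have Sfin: "finite S" using Ssub finite_subset by blast
  have Sc: "S \<subseteq> carrier_vec m" using Ssub cols by blast
  have "card S \<le> m" using li_le_dim[OF _ _ Sli] Sc dim_is_n by simp
  moreover have "det (M * M\<^sup>T) \<noteq> 0" if full: "card S = m"
  proof
    assume "det (M * M\<^sup>T) = 0"
    then obtain x where x: "x \<in> carrier_vec m" "x \<noteq> 0\<^sub>v m" "M * M\<^sup>T *\<^sub>v x = 0\<^sub>v m"
      using det_0_iff_vec_prod_zero_field[OF MM] by auto
    have y: "M\<^sup>T *\<^sub>v x \<in> carrier_vec l" using M x by simp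
    have "(M\<^sup>T *\<^sub>v x) \<bullet> (M\<^sup>T *\<^sub>v x) = x \<bullet> (M * M\<^sup>T *\<^sub>v x)"
      using transpose_vec_mult_scalar[OF M y x(1)] M x by (simp add: assoc_mult_mat_vec[of _ m l _ m])
    then have "M\<^sup>T *\<^sub>v x = 0\<^sub>v l" using x conjugate_square_eq_0_vec[OF y] by simp
    have "basis S" using dim_li_is_basis[OF _ Sfin _ Sli] Sc full dim_is_n by simp
    then have "carrier_vec m = span S" by (auto simp: basis_def)
    also have "\<dots> \<subseteq> col_space M" unfolding col_space_def using span_is_monotone[OF Ssub] .
    finally obtain z where z: "z \<in> carrier_vec l" "M *\<^sub>v z = x"
      using x(1) M unfolding col_space_eq[OF M] by auto
    have "x \<bullet> x = (M\<^sup>T *\<^sub>v x) \<bullet> z" using transpose_vec_mult_scalar[OF M z(1) x(1)] z by simp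
    also have "\<dots> = 0" using \<open>M\<^sup>T *\<^sub>v x = 0\<^sub>v l\<close> z by simp
    finally show False using x conjugate_square_eq_0_vec[OF x(1)] by simp
  qed
  moreover have "card S = m" if nz: "det (M * M\<^sup>T) \<noteq> 0"
  proof -
    obtain N where N: "N \<in> carrier_mat m m" "M * M\<^sup>T * N = 1\<^sub>m m"
      using det_non_zero_imp_unit[OF MM nz, where b = "()"] by (auto simp: Units_def ring_mat_def)
    have "x \<in> col_space M" if x: "x \<in> carrier_vec m" for x
    proof -
      have "M *\<^sub>v (M\<^sup>T *\<^sub>v (N *\<^sub>v x)) = M * M\<^sup>T * N *\<^sub>v x"
        using M N(1) x by (simp add: assoc_mult_mat_vec[of _ m m _ m] assoc_mult_mat_vec[of _ m l _ m])
      then have "M *\<^sub>v (M\<^sup>T *\<^sub>v (N *\<^sub>v x)) = x" using N x by simp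
      then show ?thesis unfolding col_space_eq[OF M] using x M N
        by (auto intro!: bexI[of _ "M\<^sup>T *\<^sub>v (N *\<^sub>v x)"])
    qed
    then have "span (set (cols M)) = carrier V"
      using span_closed cols by (auto simp: col_space_def)
    moreover have "vs (carrier V) = V" by (simp add: module_vec_def)
    ultimately have "rank M = dim" by (simp only: rank_def)
    then show ?thesis using rank dim_is_n by simp
  qed
  ultimately show ?thesis using rank by linarith
qed

text \<open>For \<open>P = [A, B]\<close> this turns the hypothesis \<open>P P\<^sup>T = 1\<close> into the splitting of \<open>V V\<^sup>T\<close> into the part kept by
the preconditioner and the part it drops.\<close>

lemma append_cols_gram:
  assumes A: "A \<in> carrier_mat n k" and B: "B \<in> carrier_mat n l"
  shows "append_cols A B * (append_cols A B)\<^sup>T = A * A\<^sup>T + B * (B :: 'a :: comm_semiring_0 mat)\<^sup>T"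
proof (rule eq_matI)
  let ?P = "append_cols A B"
  fix i j assume "i < dim_row (A * A\<^sup>T + B * B\<^sup>T)" "j < dim_col (A * A\<^sup>T + B * B\<^sup>T)"
  then have ij: "i < n" "j < n" using A B by auto
  have row: "row ?P r = row A r @\<^sub>v row B r" if "r < n" for r
    using that A B by (intro eq_vecI)
      (auto simp: append_cols_def mat_of_cols_def nth_append)
  have P: "?P \<in> carrier_mat n (k + l)"
    using A B by (auto simp: append_cols_def)
  show "(?P * ?P\<^sup>T) $$ (i, j) = (A * A\<^sup>T + B * B\<^sup>T) $$ (i, j)"
    using ij A B P by (simp add: row scalar_prod_append[of _ k _ l])
qed (use A B in \<open>auto simp: append_cols_def\<close>)

section \<open>The condition number of the preconditioned matrix\<close>

lemma spectrum_one_plus: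
  fixes A :: "real mat"
  assumes A: "A \<in> carrier_mat n n"
  shows "spectrum (1\<^sub>m n + A) = (+) 1 ` spectrum A"
proof -
  have *: "eigenvector (1\<^sub>m n + A) v e \<longleftrightarrow> eigenvector A v (e - 1)" for v e
  proof -
    have "(1\<^sub>m n + A) *\<^sub>v v = e \<cdot>\<^sub>v v \<longleftrightarrow> A *\<^sub>v v = (e - 1) \<cdot>\<^sub>v v" if v: "v \<in> carrier_vec n"
    proof -
      have "(1\<^sub>m n + A) *\<^sub>v v = v + A *\<^sub>v v"
        using A v by (simp add: add_mult_distrib_mat_vec[of _ n n])
      then show ?thesis using A v by (auto simp: vec_eq_iff algebra_simps)
    qed
    then show ?thesis using A by (auto simp: eigenvector_def)
  qed
  have "e \<in> spectrum (1\<^sub>m n + A) \<longleftrightarrow> e - 1 \<in> spectrum A" for e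
    by (simp add: spectrum_def eigenvalue_def *)
  then show ?thesis by (force simp: image_iff)
qed

theorem theorem2:
  fixes m n k l :: nat
    and D V P P1 P2 H K :: "real mat"
  assumes "0 < m"
    and "sym_pos_def m D"
    and "V \<in> carrier_mat m n"
    and "H = D + V * V\<^sup>T"
    and "P \<in> carrier_mat n n"
    and "P1 \<in> carrier_mat n k"
    and "P2 \<in> carrier_mat n l"
    and "P = append_cols P1 P2"
    and "P * P\<^sup>T = 1\<^sub>m n"
    and "K = preconditioner D V P1"
  shows "precond_cond_number K H
           \<le> 1 + lambda_max (mat_inv_sqrt K * V * P2 * P2\<^sup>T * V\<^sup>T * mat_inv_sqrt K)
       \<and> (precond_cond_number K H
           = 1 + lambda_max (mat_inv_sqrt K * V * P2 * P2\<^sup>T * V\<^sup>T * mat_inv_sqrt K)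
         \<longleftrightarrow> vec_space.rank m (V * P2) < m)"
proof -
  note m = assms(1) and D = assms(2) and V = assms(3) and H = assms(4) and P1 = assms(6)
    and P2 = assms(7) and K_def = assms(10)
  have Dc: "D \<in> carrier_mat m m" and Dt: "D\<^sup>T = D" using D by (auto simp: sym_pos_def_def)
  define X where "X = V * P1"
  define Y where "Y = V * P2"
  have X: "X \<in> carrier_mat m k" and Y: "Y \<in> carrier_mat m l"
    using V P1 P2 by (auto simp: X_def Y_def)
  have Yt: "Y\<^sup>T = P2\<^sup>T * V\<^sup>T"
    using V P2 by (simp add: Y_def transpose_mult[of _ m n])
  have K: "K = D + X * X\<^sup>T"
    using congruence_gram[OF V P1] by (simp add: K_def preconditioner_def X_def)
  have XX: "X * X\<^sup>T \<in> carrier_mat m m" and YY: "Y * Y\<^sup>T \<in> carrier_mat m m"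
    using X Y by auto
  have Kc: "K \<in> carrier_mat m m" using K Dc XX by simp
  have "P1 * P1\<^sup>T + P2 * P2\<^sup>T = 1\<^sub>m n"
    using append_cols_gram[OF P1 P2] assms(8,9) by simp
  then have "V * V\<^sup>T = V * (P1 * P1\<^sup>T + P2 * P2\<^sup>T) * V\<^sup>T" using V by simp
  also have "\<dots> = V * P1 * P1\<^sup>T * V\<^sup>T + V * P2 * P2\<^sup>T * V\<^sup>T"
    using V P1 P2 mult_add_distrib_mat[OF V, of "P1 * P1\<^sup>T" n "P2 * P2\<^sup>T"]
      add_mult_distrib_mat[of "V * (P1 * P1\<^sup>T)" m n "V * (P2 * P2\<^sup>T)" "V\<^sup>T" m]
    by (simp add: assoc_mult_mat[of V m n P1 k "P1\<^sup>T" n] assoc_mult_mat[of V m n P2 l "P2\<^sup>T" n]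
        mult_carrier_mat[of _ m n])
  also have "\<dots> = X * X\<^sup>T + Y * Y\<^sup>T"
    using congruence_gram[OF V P1] congruence_gram[OF V P2] by (simp add: X_def Y_def)
  finally have HK: "H = K + Y * Y\<^sup>T"
    using Dc XX YY by (simp add: H K assoc_add_mat[of _ m m])
  have Kpd: "sym_pos_def m K"
    unfolding sym_pos_def_def
  proof (intro conjI ballI impI)
    show "K\<^sup>T = K" using Dc Dt X XX by (simp add: K transpose_add[of _ m m] transpose_mult[of _ m k])
    fix v :: "real vec" assume v: "v \<in> carrier_vec m" "v \<noteq> 0\<^sub>v m"
    have "v \<bullet> (K *\<^sub>v v) = v \<bullet> (D *\<^sub>v v) + v \<bullet> (X * X\<^sup>T *\<^sub>v v)"
      using v Dc XX by (simp add: K add_mult_distrib_mat_vec[of _ m m] scalar_prod_add_distrib[of _ m])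
    moreover have "v \<bullet> (D *\<^sub>v v) > 0" using D v by (auto simp: sym_pos_def_def)
    moreover have "v \<bullet> (X * X\<^sup>T *\<^sub>v v) \<ge> 0" using gram_form_nonneg[OF X v(1)] .
    ultimately show "v \<bullet> (K *\<^sub>v v) > 0" by simp
  qed (fact Kc)
  define S where "S = mat_inv_sqrt K"
  note S = mat_inv_sqrt_properties[OF Kpd, folded S_def]
  define W where "W = S * Y"
  define G where "G = W * W\<^sup>T"
  have W: "W \<in> carrier_mat m l" using S(1) Y by (simp add: W_def)
  have G: "G \<in> carrier_mat m m" using W by (simp add: G_def)
  have GY: "G = S * (Y * Y\<^sup>T) * S"
    using congruence_gram[OF S(1) Y] S(1,2) Y
    by (simp add: G_def W_def assoc_mult_mat[of S m m Y l "Y\<^sup>T" m])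
  have Geq: "S * V * P2 * P2\<^sup>T * V\<^sup>T * S = G"
  proof -
    have "S * V * P2 = W"
      using S(1) V P2 by (simp add: W_def Y_def assoc_mult_mat[of S m m V n P2 l])
    then have "S * V * P2 * P2\<^sup>T * V\<^sup>T * S = W * (P2\<^sup>T * V\<^sup>T) * S"
      using W V P2 by (simp add: assoc_mult_mat[of W m l "P2\<^sup>T" n "V\<^sup>T" m])
    also have "\<dots> = W * (Y\<^sup>T * S)"
      using W Y S(1) by (simp add: Yt[symmetric] assoc_mult_mat[of W m l "Y\<^sup>T" m S m])
    also have "Y\<^sup>T * S = W\<^sup>T" using S(2) by (simp add: W_def transpose_mult[OF S(1) Y])
    finally show ?thesis by (simp add: G_def)
  qed
  have "S * H * S = S * K * S + S * (Y * Y\<^sup>T) * S"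
    using S(1) Kc YY
    by (simp add: HK mult_add_distrib_mat[of _ m m] add_mult_distrib_mat[of _ m m])
  then have SHS: "S * H * S = 1\<^sub>m m + G" using S(4) GY by simp
  have Gt: "G\<^sup>T = G" using W by (simp add: G_def transpose_mult[of _ m l])
  define \<Lambda> where "\<Lambda> = spectrum G"
  have fin: "finite \<Lambda>" using card_finite_spectrum(1)[OF G] by (simp add: \<Lambda>_def)
  have ne: "\<Lambda> \<noteq> {}"
    using real_symmetric_eigenvalue_exists[OF G Gt] m by (auto simp: \<Lambda>_def spectrum_def)
  have nonneg: "e \<ge> 0" if "e \<in> \<Lambda>" for e
    using that gram_eigenvalue_nonneg[OF W] by (simp add: \<Lambda>_def spectrum_def G_def)
  have "spectrum (S * H * S) = (+) 1 ` \<Lambda>"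
    unfolding SHS \<Lambda>_def using spectrum_one_plus[OF G] .
  then have kappa: "precond_cond_number K H = (1 + Max \<Lambda>) / (1 + Min \<Lambda>)"
    using fin ne
    by (simp add: precond_cond_number_def lambda_max_def lambda_min_def S_def
        mono_Max_commute[of "(+) 1" \<Lambda>] mono_Min_commute[of "(+) 1" \<Lambda>] mono_def)
  have min: "Min \<Lambda> \<ge> 0" and max: "Max \<Lambda> \<ge> 0" using nonneg fin ne by auto
  have "Min \<Lambda> = 0 \<longleftrightarrow> 0 \<in> \<Lambda>"
    using nonneg fin ne by (metis Min_in Min_le min order_antisym)
  also have "\<dots> \<longleftrightarrow> det G = 0"
  proof -
    have "0 \<cdot>\<^sub>v v = 0\<^sub>v m" if "v \<in> carrier_vec m" for v :: "real vec"
      using that by (intro eq_vecI) auto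
    then show ?thesis
      using G unfolding det_0_iff_vec_prod_zero_field[OF G]
      by (auto simp: \<Lambda>_def spectrum_def eigenvalue_def eigenvector_def)
  qed
  also have "\<dots> \<longleftrightarrow> det (Y * Y\<^sup>T) = 0"
    using S(1,3) YY by (simp add: GY det_mult[of _ m])
  also have "\<dots> \<longleftrightarrow> vec_space.rank m (V * P2) < m"
    using rank_less_iff_gram_singular[OF Y] by (simp add: Y_def)
  finally have rank: "Min \<Lambda> = 0 \<longleftrightarrow> vec_space.rank m (V * P2) < m" .
  have bound: "(1 + Max \<Lambda>) / (1 + Min \<Lambda>) \<le> 1 + Max \<Lambda>"
    using min max by (simp add: divide_le_eq algebra_simps)
  have eq: "(1 + Max \<Lambda>) / (1 + Min \<Lambda>) = 1 + Max \<Lambda> \<longleftrightarrow> Min \<Lambda> = 0"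
    using min max by (auto simp: divide_eq_eq algebra_simps add_nonneg_eq_0_iff)
  have "lambda_max (S * V * P2 * P2\<^sup>T * V\<^sup>T * S) = Max \<Lambda>"
    unfolding Geq by (simp add: lambda_max_def \<Lambda>_def)
  then show ?thesis using bound eq rank kappa by (simp add: S_def)
qed

end
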